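(* Let $f,g:(1,\infty)\to(1,\infty)$ be continuous, strictly increasing and onto. The following conditions are equivalent: (i) the function $C_{f,g}$ is a bivariable strict mean in $(1,\infty)$; (ii) the function $C_{f,g}$ is reflexive; (iii) the infinite product $\prod_{k=0}^{\infty} g^{-k}$ of iterates of $g^{-1}$ converges uniformly on compact subsets of $(1,\infty)$ and $$f=\prod_{k=0}^{\infty} g^{-k};$$ moreover $C_{f,g}=\mathcal{C}_g$, where $\mathcal{C}_g:(1,\infty)^2\to(1,\infty)$ defined by $$\mathcal{C}_g(x,y)=\left(\prod_{k=0}^{\infty} g^{-k+1}\right)^{-1}\left(\prod_{k=0}^{\infty} g^{-k}(x)\cdot g(y)\right),\qquad x,y>1,$$ is a strictly increasing bivariable mean in $(1,\infty)$.
   Context: For bijections $f,g$ of an interval $I\subset(0,\infty)$ closed with respect to multiplication, $C_{f,g}:I^2\to I$ is defined by $C_{f,g}(x,y)=(f\circ g)^{-1}(f(x)\cdot g(y))$, where $\circ$ is composition and $(\cdot)^{-1}$ applied to a function is its inverse function. Here $I=(1,\infty)$. For a bijection $g$, $g^{-k}$ denotes the $k$th iterate of the inverse function $g^{-1}$ ($g^{0}$ is the identity, $g^{1}=g$). Products of functions are pointwise: $\prod_{k=0}^\infty g^{-k}$ is the function $x\mapsto\prod_{k=0}^\infty g^{-k}(x)$, and $\prod_{k=0}^\infty g^{-k+1}$ is the function $x\mapsto g(x)\cdot x\cdot g^{-1}(x)\cdot g^{-2}(x)\cdots$. In the formula for $\mathcal{C}_g$, the argument of the outer inverse function is the product of the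 two numbers $\prod_{k=0}^\infty g^{-k}(x)$ and $g(y)$. A function $M:I^2\to\mathbb{R}$ is a (bivariable) mean in $I$ if $\min(x,y)\le M(x,y)\le\max(x,y)$ for all $x,y\in I$; it is a strict mean if moreover these inequalities are strict whenever $x\neq y$. $M$ is reflexive if $M(x,x)=x$ for all $x\in I$. "Strictly increasing" for a function of two variables means strictly increasing in each variable. *)

theory Defs
  imports "HOL-Analysis.Analysis"
begin

text \<open>Functions on an interval \<open>I\<close> are represented by total functions on the reals of which only the
  values on \<open>I\<close> matter; accordingly inverses are taken relative to \<open>I\<close>, and two-variable functions
  \<open>I\<^sup>2 \<rightarrow> \<real>\<close> are curried.\<close>

definition C_fun :: "real set \<Rightarrow> (real \<Rightarrow> real) \<Rightarrow> (real \<Rightarrow> real) \<Rightarrow> real \<Rightarrow> real \<Rightarrow> real" where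
  "C_fun I f g x y = inv_into I (f \<circ> g) (f x * g y)"

definition int_iterate :: "real set \<Rightarrow> (real \<Rightarrow> real) \<Rightarrow> int \<Rightarrow> real \<Rightarrow> real" where
  "int_iterate I g n = (if n \<ge> 0 then g ^^ nat n else inv_into I g ^^ nat (- n))"

definition C_cal :: "real set \<Rightarrow> (real \<Rightarrow> real) \<Rightarrow> real \<Rightarrow> real \<Rightarrow> real" where
  "C_cal I g x y =
     inv_into I (\<lambda>t. \<Prod>k. int_iterate I g (- int k + 1) t)
       ((\<Prod>k. int_iterate I g (- int k) x) * g y)"

definition mean_on :: "real set \<Rightarrow> (real \<Rightarrow> real \<Rightarrow> real) \<Rightarrow> bool" where
  "mean_on I M \<longleftrightarrow> (\<forall>x\<in>I. \<forall>y\<in>I. min x y \<le> M x y \<and> M x y \<le> max x y)"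

definition strict_mean_on :: "real set \<Rightarrow> (real \<Rightarrow> real \<Rightarrow> real) \<Rightarrow> bool" where
  "strict_mean_on I M \<longleftrightarrow> mean_on I M \<and>
     (\<forall>x\<in>I. \<forall>y\<in>I. x \<noteq> y \<longrightarrow> min x y < M x y \<and> M x y < max x y)"

definition reflexive_on :: "real set \<Rightarrow> (real \<Rightarrow> real \<Rightarrow> real) \<Rightarrow> bool" where
  "reflexive_on I M \<longleftrightarrow> (\<forall>x\<in>I. M x x = x)"

definition strictly_increasing2_on :: "real set \<Rightarrow> (real \<Rightarrow> real \<Rightarrow> real) \<Rightarrow> bool" where
  "strictly_increasing2_on I M \<longleftrightarrow>
     (\<forall>y\<in>I. strict_mono_on I (\<lambda>x. M x y)) \<and> (\<forall>x\<in>I. strict_mono_on I (\<lambda>y. M x y))"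

definition prod_converges_compactly_on :: "real set \<Rightarrow> (nat \<Rightarrow> real \<Rightarrow> real) \<Rightarrow> bool" where
  "prod_converges_compactly_on S h \<longleftrightarrow>
     (\<forall>K. compact K \<and> K \<subseteq> S \<longrightarrow>
        (\<forall>x\<in>K. convergent_prod (\<lambda>k. h k x)) \<and>
        uniform_limit K (\<lambda>n x. \<Prod>k<n. h k x) (\<lambda>x. \<Prod>k. h k x) sequentially)"

end

theory Submission
  imports Defs
begin

text \<open>Writing \<open>h\<close> for the inverse of \<open>g\<close>, reflexivity says \<open>f (g x) = f x * g x\<close>, that is
  \<open>f x = x * f (h x)\<close>, and iterating gives \<open>f x = (\<Prod>k<n. h\<^sup>k x) * f (h\<^sup>n x)\<close>. The \<open>n\<close> factors decrease
  and have product at most \<open>f x\<close>, so \<open>(h\<^sup>n x)\<^sup>n \<le> f x\<close>; by Bernoulli's inequality \<open>h\<^sup>n x\<close> tends to \<open>1\<close>,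
  hence so does \<open>f (h\<^sup>n x)\<close>. Both \<open>f\<close> and \<open>h\<close> are monotone, so the convergence on a compact set is
  controlled by its value at an upper bound of the set. Conversely, splitting off the first factor
  of the product recovers the functional equation.\<close>

section \<open>Relative inverses and integer iterates\<close>

text \<open>\<open>inv_into\<close> chooses from the predicate
  \<open>x \<in> A \<and> f x = y\<close>, which sees only values on \<open>A\<close>; the equality
  thus covers every \<open>y\<close>, also outside the image.\<close>

lemma inv_into_cong_on:
  assumes "\<And>x. x \<in> A \<Longrightarrow> f x = g x"
  shows "inv_into A f y = inv_into A g y"
proof -
  have "(\<lambda>x. x \<in> A \<and> f x = y) = (\<lambda>x. x \<in> A \<and> g x = y)"
    using assms by auto
  then show ?thesis by (simp add: inv_into_def)
qed

text \<open>At \<open>k = 0\<close> the definition takes the branch of \<open>g\<close>, but the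
  zeroth iterate is the identity in both branches; hence the case split.\<close>

lemma int_iterate_minus_nat: "int_iterate I g (- int k) = inv_into I g ^^ k"
  by (cases k) (auto simp: int_iterate_def nat_add_distrib)

text \<open>In the shifted product the factor of index 0 is \<open>g\<close> itself, so the iterates
  of the inverse start at index 1.\<close>

lemma int_iterate_one_minus_Suc: "int_iterate I g (- int (Suc k) + 1) = inv_into I g ^^ k"
  using int_iterate_minus_nat[of I g k] by simp

section \<open>Two increasing bijections and the inverse of the second\<close>

locale increasing_bij_pair =
  fixes f g :: "real \<Rightarrow> real"
  assumes f_mono: "strict_mono_on {1<..} f" and f_onto: "f ` {1<..} = {1<..}"
    and g_mono: "strict_mono_on {1<..} g" and g_onto: "g ` {1<..} = {1<..}"
begin

abbreviation h :: "real \<Rightarrow> real" where "h \<equiv> inv_into {1<..} g"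

lemma f_gt_1: "x > 1 \<Longrightarrow> f x > 1"
  using f_onto by force

lemma g_gt_1: "x > 1 \<Longrightarrow> g x > 1"
  using g_onto by force

lemma f_less_iff: "x > 1 \<Longrightarrow> y > 1 \<Longrightarrow> f x < f y \<longleftrightarrow> x < y"
  using strict_mono_on_less[OF f_mono, of x y] by simp

lemma g_less_iff: "x > 1 \<Longrightarrow> y > 1 \<Longrightarrow> g x < g y \<longleftrightarrow> x < y"
  using strict_mono_on_less[OF g_mono, of x y] by simp

lemma h_gt_1: "x > 1 \<Longrightarrow> h x > 1"
  using inv_into_into[of x g "{1<..}"] g_onto by simp

lemma g_h: "x > 1 \<Longrightarrow> g (h x) = x"
  using g_onto by (simp add: f_inv_into_f)

lemma h_g: "x > 1 \<Longrightarrow> h (g x) = x"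
  using g_mono by (simp add: inv_into_f_f strict_mono_on_imp_inj_on)

lemma h_mono: "1 < x \<Longrightarrow> x \<le> y \<Longrightarrow> h x \<le> h y"
  using g_less_iff[of "h y" "h x"] by (force simp: h_gt_1 g_h)

lemma h_pow_gt_1: "x > 1 \<Longrightarrow> (h ^^ n) x > 1"
  by (induction n) (auto simp: h_gt_1)

lemma h_pow_mono: "1 < x \<Longrightarrow> x \<le> y \<Longrightarrow> (h ^^ n) x \<le> (h ^^ n) y"
  by (induction n) (auto simp: h_mono h_pow_gt_1)

lemma prod_h_pow_pos: "x > 1 \<Longrightarrow> (\<Prod>k<n. (h ^^ k) x) > 0"
  by (intro prod_pos) (auto intro: order.strict_trans[OF zero_less_one] h_pow_gt_1)

section \<open>Order properties and reflexivity of \<open>C_fun\<close>\<close>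

text \<open>The product \<open>f x * g y\<close> exceeds 1, so it lies in the image of
  \<open>f \<circ> g\<close> and \<open>inv_into\<close> returns a genuine preimage.\<close>

lemma C_fun_gt_1: "x > 1 \<Longrightarrow> y > 1 \<Longrightarrow> C_fun {1<..} f g x y > 1"
  and fg_C_fun: "x > 1 \<Longrightarrow> y > 1 \<Longrightarrow> f (g (C_fun {1<..} f g x y)) = f x * g y"
proof -
  assume "x > 1" "y > 1"
  then have "f x * g y > 1"
    by (intro less_1_mult f_gt_1 g_gt_1)
  moreover have "(f \<circ> g) ` {1<..} = {1<..}"
    using f_onto g_onto by (simp only: image_comp [symmetric])
  ultimately have *: "f x * g y \<in> (f \<circ> g) ` {1<..}" by simp
  show "C_fun {1<..} f g x y > 1"
    using inv_into_into[OF *] by (simp add: C_fun_def)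
  show "f (g (C_fun {1<..} f g x y)) = f x * g y"
    using f_inv_into_f[OF *] by (simp add: C_fun_def)
qed

lemma fg_less_iff: "x > 1 \<Longrightarrow> y > 1 \<Longrightarrow> f (g x) < f (g y) \<longleftrightarrow> x < y"
  by (simp add: f_less_iff g_less_iff g_gt_1)

text \<open>Applying the increasing map \<open>f \<circ> g\<close> to both sides removes the
  inverse; later comparisons with \<open>C_fun\<close> become inequalities between products.\<close>

lemma C_fun_less_iff:
  "x > 1 \<Longrightarrow> y > 1 \<Longrightarrow> z > 1 \<Longrightarrow> C_fun {1<..} f g x y < z \<longleftrightarrow> f x * g y < f (g z)"
  using fg_less_iff[of "C_fun {1<..} f g x y" z] by (simp add: C_fun_gt_1 fg_C_fun)

lemma less_C_fun_iff:
  "x > 1 \<Longrightarrow> y > 1 \<Longrightarrow> z > 1 \<Longrightarrow> z < C_fun {1<..} f g x y \<longleftrightarrow> f (g z) < f x * g y"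
  using fg_less_iff[of z "C_fun {1<..} f g x y"] by (simp add: C_fun_gt_1 fg_C_fun)

lemma reflexive_on_C_fun_iff:
  "reflexive_on {1<..} (C_fun {1<..} f g) \<longleftrightarrow> (\<forall>x>1. f (g x) = f x * g x)"
proof -
  have "C_fun {1<..} f g x x = x \<longleftrightarrow> f (g x) = f x * g x" if "x > 1" for x
    \<comment> \<open>Equality is the failure of both strict inequalities, on either side.\<close>
    using C_fun_less_iff[of x x x] less_C_fun_iff[of x x x] that by (metis less_irrefl linorder_neqE)
  then show ?thesis by (auto simp: reflexive_on_def)
qed

lemma strictly_increasing2_on_C_fun: "strictly_increasing2_on {1<..} (C_fun {1<..} f g)"
proof -
  have "C_fun {1<..} f g x y < C_fun {1<..} f g x' y" if "1 < x" "x < x'" "1 < y" for x x' y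
    using that f_less_iff[of x x'] g_gt_1[of y]
    by (simp add: C_fun_less_iff C_fun_gt_1 fg_C_fun)
  moreover have "C_fun {1<..} f g x y < C_fun {1<..} f g x y'" if "1 < y" "y < y'" "1 < x" for x y y'
    using that g_less_iff[of y y'] f_gt_1[of x]
    by (simp add: C_fun_less_iff C_fun_gt_1 fg_C_fun)
  ultimately show ?thesis
    by (auto simp: strictly_increasing2_on_def strict_mono_on_def)
qed

text \<open>Start at a diagonal point, where the value is known, and change one argument at a time
  until the other diagonal point is reached; each change is strict.\<close>

lemma strict_mean_on_C_fun:
  assumes "reflexive_on {1<..} (C_fun {1<..} f g)"
  shows "strict_mean_on {1<..} (C_fun {1<..} f g)"
proof -
  let ?C = "C_fun {1<..} f g"
  have refl: "?C x x = x" if "x > 1" for x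
    using assms that by (simp add: reflexive_on_def)
  have inc1: "?C x y < ?C x' y" if "1 < x" "x < x'" "1 < y" for x x' y
    using strictly_increasing2_on_C_fun that
    by (simp add: strictly_increasing2_on_def strict_mono_on_def)
  have inc2: "?C x y < ?C x y'" if "1 < y" "y < y'" "1 < x" for x y y'
    using strictly_increasing2_on_C_fun that
    by (simp add: strictly_increasing2_on_def strict_mono_on_def)
  have strict: "min x y < ?C x y \<and> ?C x y < max x y" if "1 < x" "1 < y" "x \<noteq> y" for x y
  proof (cases "x < y")
    case True
    then show ?thesis
      using inc2[of x y x] inc1[of x y y] refl[of x] refl[of y] that by simp
  next
    case False
    then show ?thesis
      using inc1[of y x y] inc2[of y x x] refl[of x] refl[of y] that by simp
  qed
  moreover have "min x y \<le> ?C x y \<and> ?C x y \<le> max x y" if "1 < x" "1 < y" for x y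
    using strict[of x y] refl[of x] that by (cases "x = y") auto
  ultimately show ?thesis
    by (simp add: strict_mean_on_def mean_on_def)
qed

lemma reflexive_on_C_fun_if_mean:
  assumes "mean_on {1<..} (C_fun {1<..} f g)"
  shows "reflexive_on {1<..} (C_fun {1<..} f g)"
  unfolding reflexive_on_def
proof
  fix x :: real assume "x \<in> {1<..}"
  with assms have "min x x \<le> C_fun {1<..} f g x x \<and> C_fun {1<..} f g x x \<le> max x x"
    unfolding mean_on_def by blast
  then show "C_fun {1<..} f g x x = x" by simp
qed

section \<open>The functional equation and its iteration\<close>

text \<open>Substitute \<open>h x\<close> for \<open>x\<close> in one direction and
  \<open>g x\<close> in the other. The right-hand form can be iterated.\<close>

lemma f_eq_mult_f_h_iff:
  "(\<forall>x>1. f (g x) = f x * g x) \<longleftrightarrow> (\<forall>x>1. f x = x * f (h x))"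
  by (metis g_gt_1 g_h h_g h_gt_1 mult.commute)

lemma f_eq_prod:
  assumes "\<And>x. x > 1 \<Longrightarrow> f x = x * f (h x)" and "x > 1"
  shows "f x = (\<Prod>k<n. (h ^^ k) x) * f ((h ^^ n) x)"
proof (induction n)
  case (Suc n)
  then show ?case
    using assms(1)[OF h_pow_gt_1[OF assms(2), of n]] by simp
qed simp

lemma tendsto_h_pow:
  assumes eq: "\<And>x. x > 1 \<Longrightarrow> f x = x * f (h x)" and x: "x > 1"
  shows "(\<lambda>n. (h ^^ n) x) \<longlonglongrightarrow> 1"
proof (rule tendsto_sandwich)
  have "h y \<le> y" if "y > 1" for y
  proof -
    have "f (h y) < f y"
      using eq[OF that] f_gt_1[OF h_gt_1[OF that]] that by simp
    then show ?thesis using that by (simp add: f_less_iff h_gt_1)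
  qed
  then have "decseq (\<lambda>n. (h ^^ n) x)"
    using h_pow_gt_1[OF x] by (simp add: decseq_Suc_iff)
  have "(h ^^ n) x \<le> 1 + f x / real n" if "n > 0" for n
  proof -
    have "1 + real n * ((h ^^ n) x - 1) \<le> (1 + ((h ^^ n) x - 1)) ^ n"
      using h_pow_gt_1[OF x, of n] by (intro Bernoulli_inequality) simp
    also have "\<dots> = (\<Prod>k<n. (h ^^ n) x)" by simp
    also have "\<dots> \<le> (\<Prod>k<n. (h ^^ k) x)"
      using \<open>decseq _\<close> h_pow_gt_1[OF x, of n] by (intro prod_mono) (auto simp: decseq_def)
    \<comment> \<open>The inserted factor exceeds 1 and completes the product to
      \<open>f x\<close>.\<close>
    also have "\<dots> \<le> (\<Prod>k<n. (h ^^ k) x) * f ((h ^^ n) x)"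
      using f_gt_1[OF h_pow_gt_1[OF x, of n]] prod_h_pow_pos[OF x, of n] by simp
    also have "\<dots> = f x"
      using f_eq_prod[OF eq x] by simp
    finally show ?thesis
      using that by (simp add: field_simps)
  qed
  then show "\<forall>\<^sub>F n in sequentially. (h ^^ n) x \<le> 1 + f x / real n"
    by (rule eventually_mono[OF eventually_gt_at_top[of 0]])
  show "\<forall>\<^sub>F n in sequentially. 1 \<le> (h ^^ n) x"
    using h_pow_gt_1[OF x] by (simp add: less_imp_le)
  show "(\<lambda>n. 1 + f x / real n) \<longlonglongrightarrow> 1"
    using tendsto_add[OF tendsto_const lim_const_over_n[of "f x"], of 1] by simp
qed simp

text \<open>The point 1 lies outside the interval, so the limit of \<open>f\<close> there comes from
  surjectivity: a bound \<open>a > 1\<close> is a value \<open>f c\<close>, and the iterates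
  eventually drop below \<open>c\<close>.\<close>

lemma tendsto_f_h_pow:
  assumes eq: "\<And>x. x > 1 \<Longrightarrow> f x = x * f (h x)" and x: "x > 1"
  shows "(\<lambda>n. f ((h ^^ n) x)) \<longlonglongrightarrow> 1"
proof (rule order_tendstoI)
  fix a :: real assume "a < 1"
  then have "a < f ((h ^^ n) x)" for n
    using f_gt_1[OF h_pow_gt_1[OF x, of n]] by simp
  then show "\<forall>\<^sub>F n in sequentially. a < f ((h ^^ n) x)" by simp
next
  fix a :: real assume "1 < a"
  then obtain c where c: "c > 1" "a = f c"
    using f_onto by (metis greaterThan_iff imageE)
  have "\<forall>\<^sub>F n in sequentially. (h ^^ n) x < c"
    using order_tendstoD(2)[OF tendsto_h_pow[OF eq x] c(1)] .
  then show "\<forall>\<^sub>F n in sequentially. f ((h ^^ n) x) < a"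
    using h_pow_gt_1[OF x] c by (auto simp: f_less_iff elim!: eventually_mono)
qed

lemma uniform_limit_prod_h_pow:
  assumes eq: "\<And>x. x > 1 \<Longrightarrow> f x = x * f (h x)" and "b > 1"
  shows "uniform_limit {1<..b} (\<lambda>n x. \<Prod>k<n. (h ^^ k) x) f sequentially"
proof (rule uniform_limitI)
  fix e :: real assume "e > 0"
  \<comment> \<open>This majorant of the error is free of \<open>x\<close>: the partial product is
    at most \<open>f b\<close>, and the remaining factor is largest at \<open>b\<close>.\<close>
  have "(\<lambda>n. f b * (f ((h ^^ n) b) - 1)) \<longlonglongrightarrow> f b * (1 - 1)"
    by (intro tendsto_intros tendsto_f_h_pow eq \<open>b > 1\<close>)
  then have "\<forall>\<^sub>F n in sequentially. f b * (f ((h ^^ n) b) - 1) < e"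
    using \<open>e > 0\<close> by (intro order_tendstoD(2)) auto
  then show "\<forall>\<^sub>F n in sequentially. \<forall>x\<in>{1<..b}. dist (\<Prod>k<n. (h ^^ k) x) (f x) < e"
  proof (rule eventually_mono, intro ballI)
    fix n x assume less: "f b * (f ((h ^^ n) b) - 1) < e" and "x \<in> {1<..b}"
    then have x: "x > 1" "x \<le> b" by auto
    define P where "P = (\<Prod>k<n. (h ^^ k) x)"
    have fx: "f x = P * f ((h ^^ n) x)"
      unfolding P_def using f_eq_prod[OF eq x(1)] .
    have P: "P > 0"
      unfolding P_def using prod_h_pow_pos[OF x(1)] .
    have fh: "1 < f ((h ^^ n) x)"
      by (intro f_gt_1 h_pow_gt_1 x)
    have "f ((h ^^ n) x) \<le> f ((h ^^ n) b)"
      using h_pow_mono[OF x, of n] h_pow_gt_1[of x n] h_pow_gt_1[of b n] x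
      by (metis f_less_iff \<open>b > 1\<close> not_le)
    moreover have "P \<le> f b"
    proof -
      have "P \<le> f x" using P fh fx by simp
      also have "\<dots> \<le> f b" using x \<open>b > 1\<close> by (metis f_less_iff not_le)
      finally show ?thesis .
    qed
    ultimately have "P * (f ((h ^^ n) x) - 1) \<le> f b * (f ((h ^^ n) b) - 1)"
      using P fh by (intro mult_mono) auto
    moreover have "dist P (f x) = P * (f ((h ^^ n) x) - 1)"
      using P fh by (simp add: fx dist_real_def abs_if algebra_simps)
    ultimately show "dist (\<Prod>k<n. (h ^^ k) x) (f x) < e"
      using less by (simp add: P_def)
  qed
qed

lemma has_prod_h_pow:
  assumes eq: "\<And>x. x > 1 \<Longrightarrow> f x = x * f (h x)" and x: "x > 1"
  shows "(\<lambda>k. (h ^^ k) x) has_prod f x"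
proof -
  have "(\<lambda>n. \<Prod>k<n. (h ^^ k) x) \<longlonglongrightarrow> f x"
    using tendsto_uniform_limitI[OF uniform_limit_prod_h_pow[OF eq x], of x] x by simp
  \<comment> \<open>\<open>has_prod\<close> is defined by partial products that include the index
    \<open>n\<close>, and it demands a nonzero limit.\<close>
  then have "(\<lambda>n. \<Prod>k\<le>n. (h ^^ k) x) \<longlonglongrightarrow> f x"
    using LIMSEQ_lessThan_iff_atMost by blast
  then show ?thesis
    using f_gt_1[OF x] by (simp add: has_prod_def raw_has_prod_def)
qed

section \<open>From reflexivity to the infinite product\<close>

lemma reflexive_imp_product:
  assumes "reflexive_on {1<..} (C_fun {1<..} f g)"
  shows "prod_converges_compactly_on {1<..} (\<lambda>k. int_iterate {1<..} g (- int k))"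
    and "\<forall>x>1. f x = (\<Prod>k. int_iterate {1<..} g (- int k) x)"
proof -
  have eq: "f x = x * f (h x)" if "x > 1" for x
    using assms that unfolding reflexive_on_C_fun_iff f_eq_mult_f_h_iff by blast
  have hp: "(\<lambda>k. (h ^^ k) x) has_prod f x" if "x > 1" for x
    using has_prod_h_pow[OF eq that] .
  then have pf: "(\<Prod>k. (h ^^ k) x) = f x" if "x > 1" for x
    using that has_prod_iff by blast
  then show "\<forall>x>1. f x = (\<Prod>k. int_iterate {1<..} g (- int k) x)"
    by (simp add: int_iterate_minus_nat)
  show "prod_converges_compactly_on {1<..} (\<lambda>k. int_iterate {1<..} g (- int k))"
    unfolding prod_converges_compactly_on_def int_iterate_minus_nat
  proof (intro allI impI conjI ballI)
    fix K :: "real set" and x assume "compact K \<and> K \<subseteq> {1<..}" "x \<in> K"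
    then show "convergent_prod (\<lambda>k. (h ^^ k) x)"
      using hp[of x] has_prod_iff by auto
  next
    fix K :: "real set" assume K: "compact K \<and> K \<subseteq> {1<..}"
    then obtain c where c: "\<And>x. x \<in> K \<Longrightarrow> x \<le> c"
      using bounded_imp_bdd_above[OF compact_imp_bounded] by (metis bdd_above.unfold)
    \<comment> \<open>The maximum with 2 keeps the endpoint above 1, also when \<open>K\<close> is
      empty and \<open>c\<close> is arbitrary.\<close>
    have "uniform_limit {1<..max 2 c} (\<lambda>n x. \<Prod>k<n. (h ^^ k) x) f sequentially"
      by (intro uniform_limit_prod_h_pow eq) auto
    then have "uniform_limit K (\<lambda>n x. \<Prod>k<n. (h ^^ k) x) f sequentially"
      using K c by (elim uniform_limit_on_subset) force
    moreover have "uniform_limit K (\<lambda>n x. \<Prod>k<n. (h ^^ k) x) f sequentially \<longleftrightarrow>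
        uniform_limit K (\<lambda>n x. \<Prod>k<n. (h ^^ k) x) (\<lambda>x. \<Prod>k. (h ^^ k) x) sequentially"
      using K by (intro uniform_limit_cong' refl) (auto simp: pf)
    ultimately show "uniform_limit K (\<lambda>n x. \<Prod>k<n. (h ^^ k) x) (\<lambda>x. \<Prod>k. (h ^^ k) x) sequentially"
      by blast
  qed
qed

section \<open>From the infinite product to the functional equation and \<open>C_cal\<close>\<close>

text \<open>Singletons are compact, so pointwise convergence can be read off.\<close>

lemma product_has_prod:
  assumes conv: "prod_converges_compactly_on {1<..} (\<lambda>k. int_iterate {1<..} g (- int k))"
    and f: "\<forall>x>1. f x = (\<Prod>k. int_iterate {1<..} g (- int k) x)" and x: "x > 1"
  shows "(\<lambda>k. (h ^^ k) x) has_prod f x"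
proof -
  have "compact {x} \<and> {x} \<subseteq> {1<..}" using x by simp
  then have "convergent_prod (\<lambda>k. (h ^^ k) x)"
    using conv unfolding prod_converges_compactly_on_def int_iterate_minus_nat by blast
  then show ?thesis
    using f x by (simp add: has_prod_iff int_iterate_minus_nat)
qed

lemma product_imp_fg_eq:
  assumes hp: "\<And>x. x > 1 \<Longrightarrow> (\<lambda>k. (h ^^ k) x) has_prod f x" and x: "x > 1"
  shows "f (g x) = f x * g x"
proof -
  \<comment> \<open>One application of \<open>h\<close> cancels \<open>g\<close>: the product at
    \<open>x\<close> is the tail of the product at \<open>g x\<close>.\<close>
  have "(\<lambda>k. (h ^^ Suc k) (g x)) has_prod f x"
    using hp[OF x] by (simp add: funpow_swap1 h_g x)
  then have "(\<lambda>k. (h ^^ k) (g x)) has_prod (f x * (h ^^ 0) (g x))"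
    using g_gt_1[OF x] by (subst (asm) has_prod_Suc_iff) auto
  then show ?thesis
    using has_prod_unique2[OF hp[OF g_gt_1[OF x]]] by simp
qed

text \<open>The shifted product at \<open>t\<close> is \<open>g t\<close> times the product
  \<open>f t\<close>, hence \<open>f (g t)\<close>; both sides thus invert the same function at the
  same number.\<close>

lemma product_imp_C_fun_eq_C_cal:
  assumes hp: "\<And>x. x > 1 \<Longrightarrow> (\<lambda>k. (h ^^ k) x) has_prod f x" and x: "x > 1"
  shows "C_fun {1<..} f g x y = C_cal {1<..} g x y"
proof -
  have "(\<Prod>k. int_iterate {1<..} g (- int k + 1) t) = f (g t)" if t: "t > 1" for t
  proof -
    have "(\<lambda>k. int_iterate {1<..} g (- int (Suc k) + 1) t) has_prod f t"
      unfolding int_iterate_one_minus_Suc using hp[OF t] .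
    then have "(\<lambda>k. int_iterate {1<..} g (- int k + 1) t) has_prod
        (f t * int_iterate {1<..} g (- int 0 + 1) t)"
      using g_gt_1[OF t] by (subst (asm) has_prod_Suc_iff) (auto simp: int_iterate_def)
    then have "(\<lambda>k. int_iterate {1<..} g (- int k + 1) t) has_prod f (g t)"
      using product_imp_fg_eq[OF hp t] by (simp add: int_iterate_def)
    then show ?thesis using has_prod_iff by blast
  qed
  moreover have "(\<Prod>k. int_iterate {1<..} g (- int k) x) = f x"
    using hp[OF x] by (simp add: int_iterate_minus_nat has_prod_iff)
  ultimately show ?thesis
    unfolding C_fun_def C_cal_def by (auto intro: inv_into_cong_on)
qed

end

section \<open>The equivalences and the mean \<open>C_cal\<close>\<close>

text \<open>The clause after "moreover" can be read as part of (iii) or as a consequence of the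
  product formula; the last two conjuncts cover both readings.\<close>

theorem theorem3:
  fixes f g :: "real \<Rightarrow> real" and I :: "real set"
  defines "I \<equiv> {1<..}"
  assumes "continuous_on I f" and "strict_mono_on I f" and "f ` I = I"
    and "continuous_on I g" and "strict_mono_on I g" and "g ` I = I"
  shows "(strict_mean_on I (C_fun I f g) \<longleftrightarrow> reflexive_on I (C_fun I f g)) \<and>
    (reflexive_on I (C_fun I f g) \<longleftrightarrow>
       (prod_converges_compactly_on I (\<lambda>k. int_iterate I g (- int k)) \<and>
        (\<forall>x\<in>I. f x = (\<Prod>k. int_iterate I g (- int k) x))) \<and>
       (\<forall>x\<in>I. \<forall>y\<in>I. C_fun I f g x y = C_cal I g x y) \<and>
       strictly_increasing2_on I (C_cal I g) \<and> mean_on I (C_cal I g)) \<and>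
    (prod_converges_compactly_on I (\<lambda>k. int_iterate I g (- int k)) \<and>
        (\<forall>x\<in>I. f x = (\<Prod>k. int_iterate I g (- int k) x)) \<longrightarrow>
       (\<forall>x\<in>I. \<forall>y\<in>I. C_fun I f g x y = C_cal I g x y) \<and>
       strictly_increasing2_on I (C_cal I g) \<and> mean_on I (C_cal I g))"
proof -
  interpret increasing_bij_pair f g
    using assms by unfold_locales auto
  let ?C = "C_fun {1<..} f g" and ?D = "C_cal {1<..} g"
  let ?P = "prod_converges_compactly_on {1<..} (\<lambda>k. int_iterate {1<..} g (- int k)) \<and>
    (\<forall>x>1. f x = (\<Prod>k. int_iterate {1<..} g (- int k) x))"
  let ?Q = "(\<forall>x>1. \<forall>y>1. ?C x y = ?D x y) \<and> strictly_increasing2_on {1<..} ?D \<and> mean_on {1<..} ?D"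
  have strict: "strict_mean_on {1<..} ?C \<longleftrightarrow> reflexive_on {1<..} ?C"
    using strict_mean_on_C_fun reflexive_on_C_fun_if_mean by (auto simp: strict_mean_on_def)
  have refl: "reflexive_on {1<..} ?C" if ?P
    unfolding reflexive_on_C_fun_iff using product_imp_fg_eq product_has_prod that by blast
  have eq: "\<forall>x>1. \<forall>y>1. ?C x y = ?D x y" if ?P
    using product_imp_C_fun_eq_C_cal product_has_prod that by blast
  have "?Q" if ?P
  proof (intro conjI)
    show "\<forall>x>1. \<forall>y>1. ?C x y = ?D x y"
      using eq[OF that] .
    \<comment> \<open>Both this property and the mean property involve only arguments in the
      interval, where \<open>?C\<close> and \<open>?D\<close> agree, so they carry over from
      \<open>?C\<close>.\<close>
    show "strictly_increasing2_on {1<..} ?D"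
      using strictly_increasing2_on_C_fun eq[OF that]
      by (simp add: strictly_increasing2_on_def strict_mono_on_def)
    show "mean_on {1<..} ?D"
      using strict_mean_on_C_fun[OF refl[OF that]] eq[OF that]
      by (simp add: strict_mean_on_def mean_on_def)
  qed
  moreover have "?P" if "reflexive_on {1<..} ?C"
    using reflexive_imp_product[OF that] by blast
  ultimately show ?thesis
    unfolding I_def Ball_def greaterThan_iff using strict refl by blast
qed

end
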